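(* Suppose the nearring $N$ is an (internal) semidirect sum of the two nearrings $A$ and $B$. Define, with all operations computed in $N$, $$[b_1,b_2]=\langle b_1,b_2\rangle=0\ \text{ for all } b_1,b_2\in B;$$ $$\psi_b(a)=b+a-b\ \text{ for all } b\in B,\ a\in A;$$ $$\alpha_b(a_1,a_2)=a_1(a_2+b)\ \text{ for all } b\in B,\ a_1,a_2\in A;$$ $$\beta_{b_1,b_2}(a)=b_1(a+b_2)-b_1b_2\ \text{ for all } b_1,b_2\in B,\ a\in A.$$ Then $E(\psi,[-,-],\alpha,\beta,\langle-,-\rangle)$ is a quintuple of associated functions for $A$ and $B$, and $N$ is equivalent (as an extension of $A$ by $B$) to the $E$-sum $A\boxtimes B$ with these associated functions.
   Context: A nearring is a set $N$ with operations $+,\cdot$ such that $(N,+)$ is a (not necessarily abelian) group, $(N,\cdot)$ is a semigroup, and $(x+y)z=xz+yz$ for all $x,y,z\in N$ (right distributivity). It need not be zero-symmetric. An ideal $I$ of $N$ is a normal subgroup of $(N,+)$ with $in\in I$ and $n(i+m)-nm\in I$ for all $i\in I$, $n,m\in N$. A nearring $N$ is the (internal) semidirect sum of two nearrings $A$ and $B$ if $A$ is an ideal of $N$, $B$ is a subnearring of $N$, $N=A+B$, $A\cap B=0$ and $N/A\cong B$. Extensions. An extension of $A$ by $B$ is a triple $(i,N,p)$ with $N$ a nearring, $i:A\to N$ an injective nearring homomorphism with $i(A)$ an ideal of $N$, and $p:N\to B$ a surjective nearring homomorphism with $\ker(p)=i(A)$. Two extensions $(i_1,N_1,p_1)$ and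 $(i_2,N_2,p_2)$ of $A$ by $B$ are equivalent if there is a nearring isomorphism $f:N_1\to N_2$ with $f\circ i_1=i_2$ and $p_2\circ f=p_1$. A semidirect sum $N$ of $A$ and $B$ is regarded as the extension $(i,N,p)$ with $i(a)=a$ and $p(a+b)=b$ for $a\in A$, $b\in B$. An $E$-sum is regarded as the extension $(\xi,A\boxtimes B,\eta)$ with $\xi(a)=(a,0)$ and $\eta(a,b)=b$. Associated functions and $E$-sum. $\mathrm{Aut}(A,+)$ is the set of automorphisms of the additive group of $A$; $\mathrm{Map}(X,Y)$ is the set of all functions $X\to Y$; $X^2=X\times X$. A quintuple of associated functions $E(\psi,[-,-],\alpha,\beta,\langle -,-\rangle)$ for $A$ and $B$ consists of functions $\psi:B\to \mathrm{Aut}(A,+)$, $b\mapsto\psi_b$; $[-,-]:B^2\to A$; $\alpha:B\to \mathrm{Map}(A^2,A)$, $b\mapsto \alpha_b$; $\beta:B^2\to \mathrm{Map}(A,A)$, $(b_1,b_2)\mapsto\beta_{b_1,b_2}$; $\langle -,-\rangle:B^2\to A$, such that for all $b,b_1,b_2\in B$ and $a,a_1,a_2\in A$: $[b,0]=[0,b]=0$; $\alpha_b(a_1+a_2,a)=\alpha_b(a_1,a)+\alpha_b(a_2,a)$; $\alpha_0(a_1,a_2)=a_1a_2$; $\beta_{0,b}=0$ and $\beta_{b_1,b_2}(0)=0$; $\langle 0,b\rangle=0$. The $E$-sum $A\boxtimes B$ is the set $A\times B$ with the operations $(a_1,b_1)+(a_2,b_2)=(a_1+\psi_{b_1}(a_2)+[b_1,b_2],\,b_1+b_2)$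 and $(a_1,b_1)(a_2,b_2)=(\alpha_{b_2}(a_1,a_2)+\beta_{b_1,b_2}(a_2)+\langle b_1,b_2\rangle,\,b_1b_2)$. *)

theory Defs
  imports "HOL-Algebra.QuotRing"
begin

text \<open>
  A nearring is carried by the record type of rings. Nearrings need not have an identity: the
  field \<open>one\<close> of the record is unconstrained, and homomorphisms ignore it. The additive group
  need not be commutative, so the locale \<^locale>\<open>abelian_group\<close> does not apply; \<open>\<ominus>\<close> is
  nevertheless the library's inverse in \<^term>\<open>add_monoid N\<close>.
\<close>

locale nearring =
  fixes N (structure)
  assumes add_group: "group (add_monoid N)"
    and m_closed: "\<lbrakk>x \<in> carrier N; y \<in> carrier N\<rbrakk> \<Longrightarrow> x \<otimes> y \<in> carrier N"
    and m_assoc: "\<lbrakk>x \<in> carrier N; y \<in> carrier N; z \<in> carrier N\<rbrakk>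
      \<Longrightarrow> (x \<otimes> y) \<otimes> z = x \<otimes> (y \<otimes> z)"
    and distrib_right: "\<lbrakk>x \<in> carrier N; y \<in> carrier N; z \<in> carrier N\<rbrakk>
      \<Longrightarrow> (x \<oplus> y) \<otimes> z = x \<otimes> z \<oplus> y \<otimes> z"

locale nearring_ideal = nearring N for I and N (structure) +
  assumes normal_subgroup: "I \<lhd> add_monoid N"
    and ideal_r: "\<lbrakk>i \<in> I; n \<in> carrier N\<rbrakk> \<Longrightarrow> i \<otimes> n \<in> I"
    and ideal_l: "\<lbrakk>i \<in> I; n \<in> carrier N; m \<in> carrier N\<rbrakk>
      \<Longrightarrow> n \<otimes> (i \<oplus> m) \<ominus> n \<otimes> m \<in> I"

locale subnearring = nearring N for B and N (structure) +
  assumes add_subgroup: "subgroup B (add_monoid N)"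
    and sub_m_closed: "\<lbrakk>x \<in> B; y \<in> B\<rbrakk> \<Longrightarrow> x \<otimes> y \<in> B"

definition nearring_hom ::
    "('a, 'm) ring_scheme \<Rightarrow> ('b, 'n) ring_scheme \<Rightarrow> ('a \<Rightarrow> 'b) set"
  where "nearring_hom N M = {h. h \<in> hom (add_monoid N) (add_monoid M) \<and> h \<in> hom N M}"

definition nearring_iso ::
    "('a, 'm) ring_scheme \<Rightarrow> ('b, 'n) ring_scheme \<Rightarrow> ('a \<Rightarrow> 'b) set"
  where "nearring_iso N M = {h \<in> nearring_hom N M. bij_betw h (carrier N) (carrier M)}"

locale semidirect_sum =
  fixes N (structure) and A B
  assumes ideal_A: "nearring_ideal A N"
    and subnearring_B: "subnearring B N"
    and sum: "carrier N = A <+>\<^bsub>N\<^esub> B"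
    and inter: "A \<inter> B = {\<zero>}"
    and quotient: "nearring_iso (N Quot A) (N\<lparr>carrier := B\<rparr>) \<noteq> {}"

text \<open>The projection \<open>a + b \<mapsto> b\<close>; the summand \<open>b\<close> is unique because \<open>A \<inter> B = 0\<close>.\<close>

definition semidirect_proj :: "('a, 'm) ring_scheme \<Rightarrow> 'a set \<Rightarrow> 'a set \<Rightarrow> 'a \<Rightarrow> 'a"
  where "semidirect_proj N A B x = (THE b. b \<in> B \<and> (\<exists>a\<in>A. x = a \<oplus>\<^bsub>N\<^esub> b))"

locale nearring_extension =
  A: nearring A + N: nearring N + B: nearring B
  for A :: "('a, 'm) ring_scheme" and B :: "('b, 'n) ring_scheme"
    and i and N :: "('c, 'k) ring_scheme" and p +
  assumes i_hom: "i \<in> nearring_hom A N"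
    and i_inj: "inj_on i (carrier A)"
    and image_ideal: "nearring_ideal (i ` carrier A) N"
    and p_hom: "p \<in> nearring_hom N B"
    and p_surj: "p ` carrier N = carrier B"
    and kernel_eq: "a_kernel N B p = i ` carrier A"

definition equivalent_extensions ::
    "('a, 'm) ring_scheme \<Rightarrow> ('b, 'n) ring_scheme
      \<Rightarrow> ('a \<Rightarrow> 'c) \<times> ('c, 'k) ring_scheme \<times> ('c \<Rightarrow> 'b)
      \<Rightarrow> ('a \<Rightarrow> 'd) \<times> ('d, 'l) ring_scheme \<times> ('d \<Rightarrow> 'b) \<Rightarrow> bool"
  where "equivalent_extensions A B =
    (\<lambda>(i1, N1, p1) (i2, N2, p2).
      nearring_extension A B i1 N1 p1 \<and> nearring_extension A B i2 N2 p2 \<and>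
      (\<exists>f \<in> nearring_iso N1 N2.
        (\<forall>a \<in> carrier A. f (i1 a) = i2 a) \<and> (\<forall>x \<in> carrier N1. p2 (f x) = p1 x)))"

text \<open>
  Functions are only constrained on the carriers, so automorphisms of \<open>(A, +)\<close> are elements of
  \<^const>\<open>iso\<close> and not of \<open>Bij.auto\<close>, which additionally asks for extensionality.
  The functions \<open>\<kappa>\<close> and \<open>\<delta>\<close> are the square and the angle bracket; functions on pairs are curried.
\<close>

locale associated_functions =
  A: nearring A + B: nearring B
  for A :: "('a, 'm) ring_scheme" and B :: "('b, 'n) ring_scheme" +
  fixes \<psi> :: "'b \<Rightarrow> 'a \<Rightarrow> 'a" and \<kappa> :: "'b \<Rightarrow> 'b \<Rightarrow> 'a"
    and \<alpha> :: "'b \<Rightarrow> 'a \<Rightarrow> 'a \<Rightarrow> 'a" and \<beta> :: "'b \<Rightarrow> 'b \<Rightarrow> 'a \<Rightarrow> 'a"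
    and \<delta> :: "'b \<Rightarrow> 'b \<Rightarrow> 'a"
  assumes psi_aut: "\<psi> \<in> carrier B \<rightarrow> iso (add_monoid A) (add_monoid A)"
    and kappa_fun: "\<kappa> \<in> carrier B \<rightarrow> carrier B \<rightarrow> carrier A"
    and alpha_fun: "\<alpha> \<in> carrier B \<rightarrow> carrier A \<rightarrow> carrier A \<rightarrow> carrier A"
    and beta_fun: "\<beta> \<in> carrier B \<rightarrow> carrier B \<rightarrow> carrier A \<rightarrow> carrier A"
    and delta_fun: "\<delta> \<in> carrier B \<rightarrow> carrier B \<rightarrow> carrier A"
    and kappa_zero: "b \<in> carrier B \<Longrightarrow> \<kappa> b \<zero>\<^bsub>B\<^esub> = \<zero>\<^bsub>A\<^esub>"
      "b \<in> carrier B \<Longrightarrow> \<kappa> \<zero>\<^bsub>B\<^esub> b = \<zero>\<^bsub>A\<^esub>"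
    and alpha_add: "\<lbrakk>b \<in> carrier B; a1 \<in> carrier A; a2 \<in> carrier A; a \<in> carrier A\<rbrakk>
      \<Longrightarrow> \<alpha> b (a1 \<oplus>\<^bsub>A\<^esub> a2) a = \<alpha> b a1 a \<oplus>\<^bsub>A\<^esub> \<alpha> b a2 a"
    and alpha_zero: "\<lbrakk>a1 \<in> carrier A; a2 \<in> carrier A\<rbrakk>
      \<Longrightarrow> \<alpha> \<zero>\<^bsub>B\<^esub> a1 a2 = a1 \<otimes>\<^bsub>A\<^esub> a2"
    and beta_zero: "\<lbrakk>b \<in> carrier B; a \<in> carrier A\<rbrakk> \<Longrightarrow> \<beta> \<zero>\<^bsub>B\<^esub> b a = \<zero>\<^bsub>A\<^esub>"
      "\<lbrakk>b1 \<in> carrier B; b2 \<in> carrier B\<rbrakk> \<Longrightarrow> \<beta> b1 b2 \<zero>\<^bsub>A\<^esub> = \<zero>\<^bsub>A\<^esub>"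
    and delta_zero: "b \<in> carrier B \<Longrightarrow> \<delta> \<zero>\<^bsub>B\<^esub> b = \<zero>\<^bsub>A\<^esub>"

text \<open>
  The pair \<open>(0, 0)\<close> is additively idempotent because \<open>[0, 0] = 0\<close>, so it is the zero whenever
  the sum is a group at all. The field \<open>one\<close> is a dummy.
\<close>

definition E_sum ::
    "('a, 'm) ring_scheme \<Rightarrow> ('b, 'n) ring_scheme \<Rightarrow> ('b \<Rightarrow> 'a \<Rightarrow> 'a) \<Rightarrow> ('b \<Rightarrow> 'b \<Rightarrow> 'a)
      \<Rightarrow> ('b \<Rightarrow> 'a \<Rightarrow> 'a \<Rightarrow> 'a) \<Rightarrow> ('b \<Rightarrow> 'b \<Rightarrow> 'a \<Rightarrow> 'a) \<Rightarrow> ('b \<Rightarrow> 'b \<Rightarrow> 'a) \<Rightarrow> ('a \<times> 'b) ring"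
  where "E_sum A B \<psi> \<kappa> \<alpha> \<beta> \<delta> =
    \<lparr>carrier = carrier A \<times> carrier B,
     mult = (\<lambda>(a1, b1) (a2, b2).
       (\<alpha> b2 a1 a2 \<oplus>\<^bsub>A\<^esub> \<beta> b1 b2 a2 \<oplus>\<^bsub>A\<^esub> \<delta> b1 b2, b1 \<otimes>\<^bsub>B\<^esub> b2)),
     one = undefined,
     zero = (\<zero>\<^bsub>A\<^esub>, \<zero>\<^bsub>B\<^esub>),
     add = (\<lambda>(a1, b1) (a2, b2).
       (a1 \<oplus>\<^bsub>A\<^esub> \<psi> b1 a2 \<oplus>\<^bsub>A\<^esub> \<kappa> b1 b2, b1 \<oplus>\<^bsub>B\<^esub> b2))\<rparr>"

definition semidirect_extension ::
    "('a, 'm) ring_scheme \<Rightarrow> 'a set \<Rightarrow> 'a set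
      \<Rightarrow> ('a \<Rightarrow> 'a) \<times> ('a, 'm) ring_scheme \<times> ('a \<Rightarrow> 'a)"
  where "semidirect_extension N A B = (\<lambda>a. a, N, semidirect_proj N A B)"

definition E_sum_extension ::
    "('a, 'm) ring_scheme \<Rightarrow> ('b, 'n) ring_scheme \<Rightarrow> ('b \<Rightarrow> 'a \<Rightarrow> 'a) \<Rightarrow> ('b \<Rightarrow> 'b \<Rightarrow> 'a)
      \<Rightarrow> ('b \<Rightarrow> 'a \<Rightarrow> 'a \<Rightarrow> 'a) \<Rightarrow> ('b \<Rightarrow> 'b \<Rightarrow> 'a \<Rightarrow> 'a) \<Rightarrow> ('b \<Rightarrow> 'b \<Rightarrow> 'a)
      \<Rightarrow> ('a \<Rightarrow> 'a \<times> 'b) \<times> ('a \<times> 'b) ring \<times> ('a \<times> 'b \<Rightarrow> 'b)"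
  where "E_sum_extension A B \<psi> \<kappa> \<alpha> \<beta> \<delta> =
    (\<lambda>a. (a, \<zero>\<^bsub>B\<^esub>), E_sum A B \<psi> \<kappa> \<alpha> \<beta> \<delta>, \<lambda>(a, b). b)"

end

theory Submission
  imports Defs
begin

text \<open>
  Every element of \<open>N\<close> is \<open>a + b\<close> for exactly one \<open>a \<in> A\<close> and \<open>b \<in> B\<close>, because
  \<open>N = A + B\<close> and \<open>A \<inter> B = 0\<close>. Moving the summand from \<open>B\<close> to the right gives
  \<open>(a\<^sub>1 + b\<^sub>1) + (a\<^sub>2 + b\<^sub>2) = (a\<^sub>1 + (b\<^sub>1 + a\<^sub>2 - b\<^sub>1)) + (b\<^sub>1 + b\<^sub>2)\<close>, and right distributivity
  gives \<open>(a\<^sub>1 + b\<^sub>1)(a\<^sub>2 + b\<^sub>2) = (a\<^sub>1(a\<^sub>2 + b\<^sub>2) + (b\<^sub>1(a\<^sub>2 + b\<^sub>2) - b\<^sub>1b\<^sub>2)) + b\<^sub>1b\<^sub>2\<close>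
  (lemmas \<open>add_decomposition\<close> and \<open>mult_decomposition\<close>). In both formulas the first summand lies
  in \<open>A\<close> because \<open>A\<close> is an ideal, and the second lies in \<open>B\<close> because \<open>B\<close> is a subnearring. The
  same membership facts show that the functions of the theorem take values in \<open>A\<close>. Moreover, the projection
  \<open>a + b \<mapsto> b\<close> is a homomorphism with kernel \<open>A\<close>, which makes \<open>N\<close> an extension; and the formulas
  are the operations of the \<open>E\<close>-sum with the functions of the theorem, so that
  \<open>a + b \<mapsto> (a, b)\<close> is an isomorphism.

  The nearring axioms of the \<open>E\<close>-sum need no computation: it is a nearring, and an extension,
  because it is an isomorphic image of the extension \<open>N\<close> (lemma \<open>nearring_extension_transport\<close>).
\<close>

section \<open>Arithmetic and substructures of nearrings\<close>

sublocale nearring \<subseteq> add: group "add_monoid N"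
  rewrites "carrier (add_monoid N) = carrier N"
    and "mult (add_monoid N) = add N"
    and "one (add_monoid N) = zero N"
    and "m_inv (add_monoid N) = a_inv N"
  using add_group by (auto simp: a_inv_def)

context nearring
begin

lemma minus_closed:
  "\<lbrakk>x \<in> carrier N; y \<in> carrier N\<rbrakk> \<Longrightarrow> x \<ominus> y \<in> carrier N"
  by (simp add: a_minus_def)

lemma minus_self: "x \<in> carrier N \<Longrightarrow> x \<ominus> x = \<zero>"
  by (simp add: a_minus_def add.r_inv)

lemma minus_add_cancel:
  "\<lbrakk>x \<in> carrier N; y \<in> carrier N\<rbrakk> \<Longrightarrow> x \<ominus> y \<oplus> y = x"
  by (simp add: a_minus_def add.m_assoc add.l_inv)

lemma add_minus_cancel:
  "\<lbrakk>x \<in> carrier N; y \<in> carrier N\<rbrakk> \<Longrightarrow> x \<oplus> y \<ominus> y = x"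
  by (simp add: a_minus_def add.m_assoc add.r_inv)

text \<open>Only the left factor may be zero here: \<open>x \<otimes> \<zero>\<close> can differ from \<open>\<zero>\<close>.\<close>

lemma zero_mult:
  assumes "x \<in> carrier N"
  shows "\<zero> \<otimes> x = \<zero>"
proof -
  have "\<zero> \<otimes> x \<oplus> \<zero> \<otimes> x = \<zero> \<otimes> x"
    using distrib_right[of \<zero> \<zero> x] assms by simp
  then show ?thesis
    using assms by (simp add: m_closed add.r_cancel_one)
qed

lemma nearring_restrict:
  assumes "subgroup B (add_monoid N)"
    and "\<And>x y. \<lbrakk>x \<in> B; y \<in> B\<rbrakk> \<Longrightarrow> x \<otimes> y \<in> B"
  shows "nearring (N\<lparr>carrier := B\<rparr>)"
proof -
  have "B \<subseteq> carrier N"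
    using subgroup.subset[OF assms(1)] by simp
  then show ?thesis
    using subgroup.subgroup_is_group[OF assms(1) add_group] assms(2)
    by unfold_locales
      (auto simp: group_def monoid_def group_axioms_def Units_def intro: m_assoc distrib_right)
qed

end

section \<open>Transport of extensions along isomorphisms\<close>

lemma nearring_homD:
  assumes "h \<in> nearring_hom N M"
  shows "x \<in> carrier N \<Longrightarrow> h x \<in> carrier M"
    and "\<lbrakk>x \<in> carrier N; y \<in> carrier N\<rbrakk> \<Longrightarrow> h (x \<oplus>\<^bsub>N\<^esub> y) = h x \<oplus>\<^bsub>M\<^esub> h y"
    and "\<lbrakk>x \<in> carrier N; y \<in> carrier N\<rbrakk> \<Longrightarrow> h (x \<otimes>\<^bsub>N\<^esub> y) = h x \<otimes>\<^bsub>M\<^esub> h y"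
  using assms by (auto simp: nearring_hom_def hom_def)

lemma nearring_homI:
  assumes "\<And>x. x \<in> carrier N \<Longrightarrow> h x \<in> carrier M"
    and "\<And>x y. \<lbrakk>x \<in> carrier N; y \<in> carrier N\<rbrakk> \<Longrightarrow> h (x \<oplus>\<^bsub>N\<^esub> y) = h x \<oplus>\<^bsub>M\<^esub> h y"
    and "\<And>x y. \<lbrakk>x \<in> carrier N; y \<in> carrier N\<rbrakk> \<Longrightarrow> h (x \<otimes>\<^bsub>N\<^esub> y) = h x \<otimes>\<^bsub>M\<^esub> h y"
  shows "h \<in> nearring_hom N M"
  using assms by (auto simp: nearring_hom_def hom_def)

lemma nearring_hom_group_hom:
  assumes "nearring N" "nearring M" "h \<in> nearring_hom N M"
  shows "group_hom (add_monoid N) (add_monoid M) h"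
  using assms by (auto intro!: group_hom.intro group_hom_axioms.intro nearring.add_group
      simp: nearring_hom_def)

lemma nearring_hom_zero:
  assumes "nearring N" "nearring M" "h \<in> nearring_hom N M"
  shows "h \<zero>\<^bsub>N\<^esub> = \<zero>\<^bsub>M\<^esub>"
  using group_hom.hom_one[OF nearring_hom_group_hom[OF assms]] by simp

lemma nearring_hom_minus:
  assumes "nearring N" "nearring M" "h \<in> nearring_hom N M"
    and "x \<in> carrier N" "y \<in> carrier N"
  shows "h (x \<ominus>\<^bsub>N\<^esub> y) = h x \<ominus>\<^bsub>M\<^esub> h y"
proof -
  interpret N: nearring N by fact
  show ?thesis
    using group_hom.hom_inv[OF nearring_hom_group_hom[OF assms(1-3)], of y] assms(3-)
    by (simp add: a_minus_def nearring_homD a_inv_def[symmetric])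
qed

text \<open>
  By this lemma, the ideal condition on the image of \<open>i\<close> in an extension follows from the
  condition on the kernel of \<open>p\<close>, so transport does not have to move ideals along \<open>f\<close>.
\<close>

lemma kernel_nearring_ideal:
  assumes "nearring N" "nearring M" and h: "h \<in> nearring_hom N M"
  shows "nearring_ideal (a_kernel N M h) N"
proof -
  interpret N: nearring N by fact
  interpret M: nearring M by fact
  note hom = nearring_homD[OF h] nearring_hom_minus[OF assms]
  show ?thesis
  proof (rule nearring_ideal.intro[OF assms(1)], rule nearring_ideal_axioms.intro)
    show "a_kernel N M h \<lhd> add_monoid N"
      using group_hom.normal_kernel[OF nearring_hom_group_hom[OF assms]]
      by (simp add: a_kernel_def)
  qed (auto simp: a_kernel_def' hom N.m_closed N.minus_closed N.zero_mult M.zero_mult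
      M.m_closed M.minus_self)
qed

text \<open>
  The record field \<open>zero\<close> is invisible to homomorphisms, so a bijection that respects both
  operations says nothing about the field in the codomain; hence the hypothesis on \<open>f \<zero>\<close>.
\<close>

lemma nearring_transport:
  assumes "nearring N" and f: "f \<in> nearring_iso N M" and zero: "f \<zero>\<^bsub>N\<^esub> = \<zero>\<^bsub>M\<^esub>"
  shows "nearring M"
proof -
  interpret N: nearring N by fact
  have h: "f \<in> nearring_hom N M" and bij: "bij_betw f (carrier N) (carrier M)"
    using f by (auto simp: nearring_iso_def)
  note hom = nearring_homD[OF h]
  have surj: "carrier M = f ` carrier N"
    using bij by (simp add: bij_betw_def)
  have "f \<in> iso (add_monoid N) (add_monoid M)"
    using h bij by (simp add: iso_def nearring_hom_def)
  then have "group (add_monoid M)"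
    using group.iso_imp_img_group[OF N.add_group] zero by fastforce
  then show ?thesis
    by unfold_locales
      (auto simp: surj hom(2,3)[symmetric] N.m_closed N.m_assoc N.distrib_right
        group_def monoid_def group_axioms_def)
qed

lemma nearring_extension_transport:
  assumes ext: "nearring_extension A B i N p"
    and f: "f \<in> nearring_iso N M"
    and zero: "f \<zero>\<^bsub>N\<^esub> = \<zero>\<^bsub>M\<^esub>"
    and j: "\<And>a. a \<in> carrier A \<Longrightarrow> f (i a) = j a"
    and q: "\<And>x. x \<in> carrier N \<Longrightarrow> q (f x) = p x"
  shows "nearring_extension A B j M q"
proof -
  interpret nearring_extension A B i N p by fact
  have M: "nearring M"
    using nearring_transport[OF N.nearring_axioms f zero] .
  have h: "f \<in> nearring_hom N M" and bij: "bij_betw f (carrier N) (carrier M)"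
    using f by (auto simp: nearring_iso_def)
  have inj: "inj_on f (carrier N)" and surj: "carrier M = f ` carrier N"
    using bij by (auto simp: bij_betw_def)
  note f_hom = nearring_homD[OF h] and i = nearring_homD[OF i_hom] and p = nearring_homD[OF p_hom]
  have q_hom: "q \<in> nearring_hom M B"
    by (rule nearring_homI) (auto simp: surj f_hom(2,3)[symmetric] q p N.m_closed)
  have "a_kernel M B q = f ` a_kernel N B p"
    by (auto simp: a_kernel_def' surj q)
  also have "\<dots> = j ` carrier A"
    unfolding kernel_eq image_image using j by simp
  finally have kernel: "a_kernel M B q = j ` carrier A" .
  show ?thesis
  proof (rule nearring_extension.intro[OF A.nearring_axioms M B.nearring_axioms],
      rule nearring_extension_axioms.intro)
    show "j \<in> nearring_hom A M"
      by (rule nearring_homI) (simp_all add: j[symmetric] f_hom i A.m_closed)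
    show "inj_on j (carrier A)"
      using i_inj inj i(1) by (auto simp: inj_on_def j[symmetric])
    show "nearring_ideal (j ` carrier A) M"
      using kernel_nearring_ideal[OF M B.nearring_axioms q_hom] by (simp add: kernel)
    show "q ` carrier M = carrier B"
      using p_surj by (auto simp: surj q image_image)
  qed (fact q_hom kernel)+
qed

section \<open>The decomposition of a semidirect sum\<close>

sublocale semidirect_sum \<subseteq> nearring N
  using ideal_A by (rule nearring_ideal.axioms(1))

context semidirect_sum
begin

lemma normal_A: "A \<lhd> add_monoid N"
  using nearring_ideal.normal_subgroup[OF ideal_A] .

lemma subgroup_A: "subgroup A (add_monoid N)"
  using normal_A by (rule normal_imp_subgroup)

lemma subgroup_B: "subgroup B (add_monoid N)"
  using subnearring.add_subgroup[OF subnearring_B] .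

lemmas A_carrier = subgroup.mem_carrier[OF subgroup_A, simplified]
  and A_add = subgroup.m_closed[OF subgroup_A, simplified]
  and A_zero = subgroup.one_closed[OF subgroup_A, simplified]
  and A_uminus = subgroup.m_inv_closed[OF subgroup_A, folded a_inv_def]
  and B_carrier = subgroup.mem_carrier[OF subgroup_B, simplified]
  and B_add = subgroup.m_closed[OF subgroup_B, simplified]
  and B_zero = subgroup.one_closed[OF subgroup_B, simplified]
  and B_uminus = subgroup.m_inv_closed[OF subgroup_B, folded a_inv_def]
  and A_mult = nearring_ideal.ideal_r[OF ideal_A]
  and B_mult = subnearring.sub_m_closed[OF subnearring_B]
  and ideal_l = nearring_ideal.ideal_l[OF ideal_A]

lemma conj_A:
  "\<lbrakk>x \<in> carrier N; a \<in> A\<rbrakk> \<Longrightarrow> x \<oplus> a \<ominus> x \<in> A"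
  using normal.inv_op_closed2[OF normal_A, of x a] by (simp add: a_minus_def a_inv_def)

lemma nearring_A: "nearring (N\<lparr>carrier := A\<rparr>)"
  by (rule nearring_restrict[OF subgroup_A]) (simp add: A_mult A_carrier)

lemma nearring_B: "nearring (N\<lparr>carrier := B\<rparr>)"
  by (rule nearring_restrict[OF subgroup_B]) (simp add: B_mult)

lemma carrier_decomposition:
  assumes "x \<in> carrier N"
  obtains a b where "a \<in> A" "b \<in> B" "x = a \<oplus> b"
  using assms by (auto simp: sum set_add_def')

text \<open>Two decompositions differ by an element of \<open>A \<inter> B\<close>.\<close>

lemma decomposition_unique:
  assumes a: "a \<in> A" "a' \<in> A" and b: "b \<in> B" "b' \<in> B" and eq: "a \<oplus> b = a' \<oplus> b'"
  shows "a = a'" "b = b'"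
proof -
  note car = a[THEN A_carrier] b[THEN B_carrier]
  have "\<ominus> a' \<oplus> a = \<ominus> a' \<oplus> (a \<oplus> b \<ominus> b)"
    using car by (simp add: add_minus_cancel)
  also have "\<dots> = b' \<ominus> b"
    using car by (simp add: eq a_minus_def add.m_assoc[symmetric] add.l_inv)
  finally have diff: "\<ominus> a' \<oplus> a = b' \<ominus> b" .
  have "\<ominus> a' \<oplus> a \<in> A"
    using a by (simp add: A_add A_uminus)
  moreover have "b' \<ominus> b \<in> B"
    using b by (simp add: a_minus_def B_add B_uminus)
  ultimately have "b' \<ominus> b = \<zero>"
    using diff inter by auto
  then show "b = b'"
    using minus_add_cancel[of b' b] car by simp
  then show "a = a'"
    using eq car by simp
qed

lemma add_decomposition:
  assumes "a1 \<in> carrier N" "b1 \<in> carrier N" "a2 \<in> carrier N" "b2 \<in> carrier N"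
  shows "(a1 \<oplus> b1) \<oplus> (a2 \<oplus> b2) = (a1 \<oplus> (b1 \<oplus> a2 \<ominus> b1)) \<oplus> (b1 \<oplus> b2)"
proof -
  have "b1 \<oplus> (a2 \<oplus> b2) = (b1 \<oplus> a2 \<ominus> b1 \<oplus> b1) \<oplus> b2"
    using assms by (simp add: minus_add_cancel add.m_assoc)
  then show ?thesis
    using assms by (simp add: add.m_assoc minus_closed)
qed

lemma mult_decomposition:
  assumes "a1 \<in> carrier N" "b1 \<in> carrier N" "a2 \<in> carrier N" "b2 \<in> carrier N"
  shows "(a1 \<oplus> b1) \<otimes> (a2 \<oplus> b2)
    = (a1 \<otimes> (a2 \<oplus> b2) \<oplus> (b1 \<otimes> (a2 \<oplus> b2) \<ominus> b1 \<otimes> b2)) \<oplus> b1 \<otimes> b2"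
  using assms by (simp add: distrib_right m_closed minus_closed minus_add_cancel add.m_assoc)

section \<open>The projection and the extension\<close>

abbreviation proj where "proj \<equiv> semidirect_proj N A B"

lemma proj_add:
  assumes "a \<in> A" "b \<in> B"
  shows "proj (a \<oplus> b) = b"
  unfolding semidirect_proj_def
  using assms decomposition_unique(2) by (intro the_equality) blast+

lemma proj_sum:
  assumes "a1 \<in> A" "b1 \<in> B" "a2 \<in> A" "b2 \<in> B"
  shows "proj ((a1 \<oplus> b1) \<oplus> (a2 \<oplus> b2)) = b1 \<oplus> b2"
  using assms
  by (subst add_decomposition) (simp_all add: A_carrier B_carrier proj_add A_add B_add conj_A)

lemma proj_prod:
  assumes "a1 \<in> A" "b1 \<in> B" "a2 \<in> A" "b2 \<in> B"
  shows "proj ((a1 \<oplus> b1) \<otimes> (a2 \<oplus> b2)) = b1 \<otimes> b2"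
  using assms
  by (simp add: mult_decomposition A_carrier B_carrier proj_add A_add A_mult B_mult ideal_l)

lemma proj_hom: "proj \<in> nearring_hom N (N\<lparr>carrier := B\<rparr>)"
proof (rule nearring_homI)
  fix x y assume xy: "x \<in> carrier N" "y \<in> carrier N"
  obtain a1 b1 where x: "a1 \<in> A" "b1 \<in> B" "x = a1 \<oplus> b1"
    using xy(1) by (rule carrier_decomposition)
  obtain a2 b2 where y: "a2 \<in> A" "b2 \<in> B" "y = a2 \<oplus> b2"
    using xy(2) by (rule carrier_decomposition)
  show "proj x \<in> carrier (N\<lparr>carrier := B\<rparr>)"
    using x by (simp add: proj_add)
  show "proj (x \<oplus> y) = proj x \<oplus>\<^bsub>N\<lparr>carrier := B\<rparr>\<^esub> proj y"
    using x y by (simp add: proj_add proj_sum)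
  show "proj (x \<otimes> y) = proj x \<otimes>\<^bsub>N\<lparr>carrier := B\<rparr>\<^esub> proj y"
    using x y by (simp add: proj_add proj_prod)
qed

lemma proj_on_A: "a \<in> A \<Longrightarrow> proj a = \<zero>"
  using proj_add[of a \<zero>] by (simp add: B_zero A_carrier)

lemma proj_on_B: "b \<in> B \<Longrightarrow> proj b = b"
  using proj_add[of \<zero> b] by (simp add: A_zero B_carrier)

lemma semidirect_is_extension:
  "nearring_extension (N\<lparr>carrier := A\<rparr>) (N\<lparr>carrier := B\<rparr>) (\<lambda>a. a) N proj"
proof (rule nearring_extension.intro[OF nearring_A nearring_axioms nearring_B],
    rule nearring_extension_axioms.intro)
  show "(\<lambda>a. a) \<in> nearring_hom (N\<lparr>carrier := A\<rparr>) N"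
    by (rule nearring_homI) (simp_all add: A_carrier)
  show "nearring_ideal ((\<lambda>a. a) ` carrier (N\<lparr>carrier := A\<rparr>)) N"
    using ideal_A by simp
  show "proj \<in> nearring_hom N (N\<lparr>carrier := B\<rparr>)"
    by (rule proj_hom)
  show "proj ` carrier N = carrier (N\<lparr>carrier := B\<rparr>)"
    using nearring_homD(1)[OF proj_hom] proj_on_B B_carrier by force
  show "a_kernel N (N\<lparr>carrier := B\<rparr>) proj = (\<lambda>a. a) ` carrier (N\<lparr>carrier := A\<rparr>)"
    by (auto simp: a_kernel_def' proj_on_A A_carrier proj_add elim!: carrier_decomposition)
qed simp

section \<open>The associated functions\<close>

lemma conj_iso:
  assumes "b \<in> carrier N"
  shows "(\<lambda>a. b \<oplus> a \<ominus> b) \<in> iso (add_monoid (N\<lparr>carrier := A\<rparr>)) (add_monoid (N\<lparr>carrier := A\<rparr>))"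
proof -
  have cancel: "c \<oplus> (\<ominus> c \<oplus> x) = x" "\<ominus> c \<oplus> (c \<oplus> x) = x"
    if "c \<in> carrier N" "x \<in> carrier N" for c x
    using that by (simp_all add: add.m_assoc[symmetric] add.l_inv add.r_inv)
  have "(b \<oplus> x \<ominus> b) \<oplus> (b \<oplus> y \<ominus> b) = b \<oplus> (x \<oplus> y) \<ominus> b" if "x \<in> A" "y \<in> A" for x y
    using that assms by (simp add: a_minus_def add.m_assoc A_carrier cancel)
  moreover have "bij_betw (\<lambda>a. b \<oplus> a \<ominus> b) A A"
  proof (rule bij_betw_byWitness[where f' = "\<lambda>a. \<ominus> b \<oplus> a \<ominus> (\<ominus> b)"])
    show "\<forall>a\<in>A. \<ominus> b \<oplus> (b \<oplus> a \<ominus> b) \<ominus> (\<ominus> b) = a"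
      and "\<forall>a\<in>A. b \<oplus> (\<ominus> b \<oplus> a \<ominus> (\<ominus> b)) \<ominus> b = a"
      using assms by (simp_all add: a_minus_def add.m_assoc A_carrier cancel add.l_inv add.r_inv)
  qed (use assms conj_A in auto)
  ultimately show ?thesis
    using assms by (auto simp: iso_def hom_def conj_A)
qed

end

theorem proposition3p3:
  fixes N :: "('a, 'm) ring_scheme" (structure) and A B :: "'a set"
    and \<psi> :: "'a \<Rightarrow> 'a \<Rightarrow> 'a" and \<kappa> :: "'a \<Rightarrow> 'a \<Rightarrow> 'a"
    and \<alpha> :: "'a \<Rightarrow> 'a \<Rightarrow> 'a \<Rightarrow> 'a" and \<beta> :: "'a \<Rightarrow> 'a \<Rightarrow> 'a \<Rightarrow> 'a"
    and \<delta> :: "'a \<Rightarrow> 'a \<Rightarrow> 'a"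
  assumes "semidirect_sum N A B"
    and "\<And>b1 b2. \<lbrakk>b1 \<in> B; b2 \<in> B\<rbrakk> \<Longrightarrow> \<kappa> b1 b2 = \<zero>"
    and "\<And>b1 b2. \<lbrakk>b1 \<in> B; b2 \<in> B\<rbrakk> \<Longrightarrow> \<delta> b1 b2 = \<zero>"
    and "\<And>b a. \<lbrakk>b \<in> B; a \<in> A\<rbrakk> \<Longrightarrow> \<psi> b a = b \<oplus> a \<ominus> b"
    and "\<And>b a1 a2. \<lbrakk>b \<in> B; a1 \<in> A; a2 \<in> A\<rbrakk> \<Longrightarrow> \<alpha> b a1 a2 = a1 \<otimes> (a2 \<oplus> b)"
    and "\<And>b1 b2 a. \<lbrakk>b1 \<in> B; b2 \<in> B; a \<in> A\<rbrakk>
      \<Longrightarrow> \<beta> b1 b2 a = b1 \<otimes> (a \<oplus> b2) \<ominus> b1 \<otimes> b2"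
  shows "associated_functions (N\<lparr>carrier := A\<rparr>) (N\<lparr>carrier := B\<rparr>) \<psi> \<kappa> \<alpha> \<beta> \<delta> \<and>
    equivalent_extensions (N\<lparr>carrier := A\<rparr>) (N\<lparr>carrier := B\<rparr>)
      (semidirect_extension N A B)
      (E_sum_extension (N\<lparr>carrier := A\<rparr>) (N\<lparr>carrier := B\<rparr>) \<psi> \<kappa> \<alpha> \<beta> \<delta>)"
proof -
  interpret semidirect_sum N A B by fact
  note \<kappa> = assms(2) and \<delta> = assms(3) and \<psi> = assms(4) and \<alpha> = assms(5) and \<beta> = assms(6)
  let ?A = "N\<lparr>carrier := A\<rparr>" and ?B = "N\<lparr>carrier := B\<rparr>"
  let ?E = "E_sum ?A ?B \<psi> \<kappa> \<alpha> \<beta> \<delta>"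
  note mem = A_carrier B_carrier A_zero B_zero A_add B_add A_mult B_mult
  have associated: "associated_functions ?A ?B \<psi> \<kappa> \<alpha> \<beta> \<delta>"
  proof (rule associated_functions.intro[OF nearring_A nearring_B],
      rule associated_functions_axioms.intro)
    show "\<psi> \<in> carrier ?B \<rightarrow> iso (add_monoid ?A) (add_monoid ?A)"
    proof
      fix b assume "b \<in> carrier ?B"
      then have b: "b \<in> B" by simp
      \<comment> \<open>Off \<open>A\<close>, \<open>\<psi> b\<close> is arbitrary, so it cannot be rewritten to conjugation as a function.\<close>
      have "bij_betw (\<psi> b) A A \<longleftrightarrow> bij_betw (\<lambda>a. b \<oplus> a \<ominus> b) A A"
        using b by (intro bij_betw_cong) (simp add: \<psi>)
      then show "\<psi> b \<in> iso (add_monoid ?A) (add_monoid ?A)"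
        using conj_iso[OF B_carrier[OF b]] b
        by (auto simp: iso_def hom_def \<psi> mem Pi_iff)
    qed
  qed (auto simp: \<kappa> \<delta> \<alpha> \<beta> mem ideal_l distrib_right zero_mult m_closed minus_self)
  \<comment> \<open>The inverse of \<open>(a, b) \<mapsto> a + b\<close>.\<close>
  define f where "f x = (x \<ominus> proj x, proj x)" for x
  have f_add: "f (a \<oplus> b) = (a, b)" if "a \<in> A" "b \<in> B" for a b
    using that by (simp add: f_def proj_add add_minus_cancel mem)
  have f_hom: "f \<in> nearring_hom N ?E"
  proof (rule nearring_homI)
    fix x y assume xy: "x \<in> carrier N" "y \<in> carrier N"
    obtain a1 b1 where x: "a1 \<in> A" "b1 \<in> B" "x = a1 \<oplus> b1"
      using xy(1) by (rule carrier_decomposition)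
    obtain a2 b2 where y: "a2 \<in> A" "b2 \<in> B" "y = a2 \<oplus> b2"
      using xy(2) by (rule carrier_decomposition)
    show "f x \<in> carrier ?E"
      using x by (simp add: E_sum_def f_add)
    show "f (x \<oplus> y) = f x \<oplus>\<^bsub>?E\<^esub> f y"
      using x(1,2) y(1,2) unfolding x(3) y(3)
      by (subst add_decomposition) (simp_all add: E_sum_def f_add \<kappa> \<psi> mem conj_A)
    show "f (x \<otimes> y) = f x \<otimes>\<^bsub>?E\<^esub> f y"
      using x y by (simp add: mult_decomposition E_sum_def f_add \<alpha> \<beta> \<delta> mem ideal_l)
  qed
  moreover have "bij_betw f (carrier N) (carrier ?E)"
  proof (rule bij_betw_byWitness[where f' = "\<lambda>(a, b). a \<oplus> b"])
    show "\<forall>x\<in>carrier N. (case f x of (a, b) \<Rightarrow> a \<oplus> b) = x"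
      by (auto simp: f_add elim!: carrier_decomposition)
    show "f ` carrier N \<subseteq> carrier ?E"
      using nearring_homD(1)[OF f_hom] by blast
  qed (auto simp: f_add E_sum_def mem)
  ultimately have f_iso: "f \<in> nearring_iso N ?E"
    by (simp add: nearring_iso_def)
  have f_A: "f a = (a, \<zero>)" if "a \<in> A" for a
    using f_add[of a \<zero>] that by (simp add: mem)
  have f_proj: "(case f x of (a, b) \<Rightarrow> b) = proj x" for x
    by (simp add: f_def)
  have "nearring_extension ?A ?B (\<lambda>a. (a, \<zero>)) ?E (\<lambda>(a, b). b)"
    by (rule nearring_extension_transport[OF semidirect_is_extension f_iso])
      (simp_all add: f_A f_proj A_zero E_sum_def)
  then have "equivalent_extensions ?A ?B (semidirect_extension N A B)
      (E_sum_extension ?A ?B \<psi> \<kappa> \<alpha> \<beta> \<delta>)"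
    using semidirect_is_extension f_iso f_A f_proj
    by (auto simp: equivalent_extensions_def semidirect_extension_def E_sum_extension_def)
  with associated show ?thesis by simp
qed

end
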